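(* Consider a distributed storage system $\mathcal{D}(n,k,d)$ with $d=n-1$ operating in the bandwidth-limited regime with repair-bandwidth budget $\Gamma$, in the presence of an omniscient adversary controlling $b$ nodes. If $2b<k$, the resiliency capacity is \[ C_r^{BL}(\Gamma)=\sum_{i=2b+1}^{k}(n-i)\beta,\qquad \beta=\frac{\Gamma}{n-1}, \] achieved with node storage capacity $\alpha=\Gamma$. If $2b\ge k$, then $C_r^{BL}(\Gamma)=0$.
   Context: A distributed storage system (DSS) $\mathcal{D}(n,k,d)$, $k\le d\le n-1$: a source stores a file on $n$ storage nodes, each storing at most $\alpha$ symbols of a finite field $\mathbb{F}_q$. Nodes fail one at a time; each failed node is replaced by a new node that connects to some $d$ of the remaining $n-1$ active nodes and downloads $\beta=\gamma/d$ symbols from each (symmetric repair; $\gamma$ is the repair bandwidth), then stores at most $\alpha$ symbols. A data collector connects to any $k$ simultaneously active nodes, downloads their stored contents, and must recover the file. An omniscient adversary knows the file, the storage/repair/decoding schemes and all stored data, and may control any $b$ nodes among all nodes ever in the system (possibly at different times): for a controlled node it may arbitrarily alter the stored data and the messages that node sends during repair and to data collectors. The resiliency capacity $C_r(\alpha,\gamma)$ is the maximum file size that can be stored so that every data collector, for any failure/repair sequence, recovers the file correctly whatever the adversary does. The bandwidth-limited resiliency capacity is $C_r^{BL}(\Gamma)=\sup_{\gamma\le\Gamma,\ \alpha\ge0}C_r(\alpha,\gamma)$. Symbol counts are taken so that $\beta=\Gamma/(n-1)$ is a positive integer and $q$ is large enough for the required MDS codes to exist. *)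

theory Defs
  imports Main "HOL-Library.Extended_Nat" "HOL-Computational_Algebra.Primes"
begin

text \<open>Generic (possibly nonlinear, history-dependent, deterministic) storage/repair/decoding
schemes over an alphabet of size q (the symbols of F_q are identified with 0..q-1; since
schemes are arbitrary functions only the alphabet size matters).  Storage slots are 0..n-1.
A failure/repair history is a list of steps (f, H): the node in slot f fails and its
replacement downloads from the active nodes in the helper slots H (|H| = d).
A node in the system is identified by (time of creation, slot); initial nodes have time 0,
the newcomer of repair step t (t = 1,2,...) has time t.\<close>

type_synonym hist = "(nat \<times> nat set) list"

definition syms :: "nat \<Rightarrow> nat \<Rightarrow> nat list set" where
  "syms q m = {xs. length xs = m \<and> set xs \<subseteq> {..<q}}"

fun birth :: "hist \<Rightarrow> nat \<Rightarrow> nat \<Rightarrow> nat" where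
  "birth fs 0 j = 0"
| "birth fs (Suc t) j = (if fst (fs ! t) = j then Suc t else birth fs t j)"

text \<open>Contents of the honest nodes after t repair steps.  enc i x: initial content of slot i;
msg h r j c: message sent by helper slot j (with stored content c) in repair step r given
earlier history h; store h r m: content stored by the newcomer given the received messages m;
B: set of adversarial nodes; badmsg t j: the message a controlled helper in slot j sends
during repair step t+1.\<close>
primrec state ::
  "(nat \<Rightarrow> nat list \<Rightarrow> nat list) \<Rightarrow>
   (hist \<Rightarrow> nat \<times> nat set \<Rightarrow> nat \<Rightarrow> nat list \<Rightarrow> nat list) \<Rightarrow>
   (hist \<Rightarrow> nat \<times> nat set \<Rightarrow> (nat \<Rightarrow> nat list) \<Rightarrow> nat list) \<Rightarrow>
   nat list \<Rightarrow> hist \<Rightarrow> (nat \<times> nat) set \<Rightarrow> (nat \<Rightarrow> nat \<Rightarrow> nat list) \<Rightarrow>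
   nat \<Rightarrow> nat \<Rightarrow> nat list" where
  "state enc msg store x fs B badmsg 0 = (\<lambda>i. enc i x)"
| "state enc msg store x fs B badmsg (Suc t) =
     (let s = state enc msg store x fs B badmsg t;
          r = fs ! t;
          m = (\<lambda>j. if j \<in> snd r then
                     (if (birth fs t j, j) \<in> B then badmsg t j
                      else msg (take t fs) r j (s j))
                   else [])
      in (\<lambda>i. if i = fst r then store (take t fs) r m else s i))"

definition valid_hist :: "nat \<Rightarrow> nat \<Rightarrow> hist \<Rightarrow> bool" where
  "valid_hist n d fs \<longleftrightarrow>
     (\<forall>(f, H) \<in> set fs. f < n \<and> H \<subseteq> {..<n} - {f} \<and> card H = d)"

definition resilient :: "nat \<Rightarrow> nat \<Rightarrow> nat \<Rightarrow> nat \<Rightarrow> nat \<Rightarrow> nat \<Rightarrow> nat \<Rightarrow> nat \<Rightarrow> bool" where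
  "resilient q n k d b M \<alpha> \<beta> \<longleftrightarrow>
    (\<exists>enc msg store dec.
       (\<forall>i x. enc i x \<in> syms q \<alpha>) \<and>
       (\<forall>h r j c. msg h r j c \<in> syms q \<beta>) \<and>
       (\<forall>h r m. store h r m \<in> syms q \<alpha>) \<and>
       (\<forall>x \<in> syms q M. \<forall>fs. valid_hist n d fs \<longrightarrow>
         (\<forall>B. finite B \<and> card B \<le> b \<longrightarrow>
          (\<forall>badmsg badread.
             (\<forall>t j. badmsg t j \<in> syms q \<beta>) \<longrightarrow> (\<forall>i. badread i \<in> syms q \<alpha>) \<longrightarrow>
             (\<forall>K. K \<subseteq> {..<n} \<and> card K = k \<longrightarrow>
                dec fs K (\<lambda>i. if i \<in> K then
                              (if (birth fs (length fs) i, i) \<in> B then badread i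
                               else state enc msg store x fs B badmsg (length fs) i)
                            else []) = x)))))"

text \<open>Bandwidth-limited resiliency capacity with budget Gamma = d * beta:
sup over gamma = d*beta' <= Gamma and all alpha of the resiliency capacity.\<close>
definition capacity_BL :: "nat \<Rightarrow> nat \<Rightarrow> nat \<Rightarrow> nat \<Rightarrow> nat \<Rightarrow> nat \<Rightarrow> enat" where
  "capacity_BL q n k d b \<beta> =
     Sup {enat M | M. \<exists>\<alpha> \<beta>'. \<beta>' \<le> \<beta> \<and> resilient q n k d b M \<alpha> \<beta>'}"

end

theory Submission
  imports Defs "HOL-Computational_Algebra.Computational_Algebra" "HOL-Library.FuncSet"
begin

text \<open>Achievability is repair by transfer: an MDS code whose dimension is the file size \<open>M\<close> puts \<open>\<beta>\<close> symbols on every edge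
  of the complete graph on the slots, and slot \<open>i\<close> stores the edges at \<open>i\<close>. Controlling \<open>b\<close> nodes
  spoils only edges at \<open>b\<close> slots, and two files that both explain what a data collector reads agree
  on all edges that meet the \<open>k\<close> read slots and avoid some \<open>2b\<close> slots; there are at least \<open>M\<close> such
  symbols. For the converse, slots \<open>0, \<dots>, k - 1\<close> fail in turn. A file longer than the bound
  leaves two files with the same messages from original nodes to the newcomers
  \<open>2b, \<dots>, k - 1\<close>, and the adversary hides which of the two is stored by controlling half of the
  first \<open>2b\<close> newcomers. The MDS codes are Reed--Solomon codes over \<open>\<F>\<^sub>p[X]/(f)\<close>, where \<open>f\<close> need not be
  irreducible: it suffices that the evaluation points differ by units.\<close>

section \<open>MDS codes over prime power alphabets\<close>

text \<open>Dividing off the linear factor at one point leaves a quotient that vanishes modulo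
  \<open>I\<close> at the other points, since \<open>a t - a s\<close> is a unit there. Unit
  differences thus replace the absence of zero divisors.\<close>

lemma coeff_in_ideal_of_roots:
  fixes g :: "'a::comm_ring_1 poly"
  assumes I0: "0 \<in> I" and Iadd: "\<And>x y. x \<in> I \<Longrightarrow> y \<in> I \<Longrightarrow> x + y \<in> I"
    and Imult: "\<And>x y. y \<in> I \<Longrightarrow> x * y \<in> I"
    and "finite S" and "\<And>i. i \<ge> card S \<Longrightarrow> coeff g i = 0"
    and "\<And>s. s \<in> S \<Longrightarrow> poly g (a s) \<in> I"
    and "\<And>s t. s \<in> S \<Longrightarrow> t \<in> S \<Longrightarrow> s \<noteq> t \<Longrightarrow> \<exists>u. (a s - a t) * u - 1 \<in> I"
  shows "coeff g i \<in> I"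
  using assms(4-)
proof (induction S arbitrary: g i rule: finite_induct)
  case empty
  then show ?case using I0 by simp
next
  case (insert s S)
  have Idiff: "x - y \<in> I" if "x \<in> I" "y \<in> I" for x y
    using Iadd[OF that(1) Imult[OF that(2), of "-1"]] by simp
  define h where "h = synthetic_div g (a s)"
  have g: "g = [:- a s, 1:] * h + [:poly g (a s):]"
    unfolding h_def by (rule synthetic_div_correct'[symmetric])
  have gs: "poly g (a s) \<in> I"
    using insert.prems(2) by simp
  have hcoeff: "coeff h j \<in> I" for j
  proof (rule insert.IH)
    fix j assume j: "j \<ge> card S"
    show "coeff h j = 0"
    proof (rule ccontr)
      assume h0: "coeff h j \<noteq> 0"
      then have "j \<le> degree g - 1"
        unfolding h_def by (metis degree_synthetic_div le_degree)
      moreover have "degree g \<noteq> 0"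
        using h0 synthetic_div_eq_0_iff[of g "a s"] by (auto simp: h_def)
      ultimately have "degree g \<ge> card (insert s S)"
        using j insert.hyps by simp
      then have "lead_coeff g = 0"
        by (rule insert.prems(1))
      then show False using \<open>degree g \<noteq> 0\<close> by simp
    qed
  next
    fix t assume t: "t \<in> S"
    then obtain u where u: "(a t - a s) * u - 1 \<in> I"
      using insert.prems(3)[of t s] insert.hyps by blast
    have "poly g (a t) = (a t - a s) * poly h (a t) + poly g (a s)"
      by (subst g) (simp add: algebra_simps)
    then have "(a t - a s) * poly h (a t) \<in> I"
      using Idiff[OF insert.prems(2)[of t] gs] t by simp
    \<comment> \<open>This difference equals \<open>poly h (a t)\<close>: cancellation by the
      inverse \<open>u\<close>.\<close>
    then have "u * ((a t - a s) * poly h (a t)) - poly h (a t) * ((a t - a s) * u - 1) \<in> I"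
      using Idiff Imult u by blast
    then show "poly h (a t) \<in> I"
      by (simp add: algebra_simps)
  next
    fix s' t assume "s' \<in> S" "t \<in> S" "s' \<noteq> t"
    then show "\<exists>u. (a s' - a t) * u - 1 \<in> I"
      using insert.prems(3) by blast
  qed
  have 1: "coeff (smult (- a s) h) i \<in> I"
    using Imult[OF hcoeff, of "- a s" i] by simp
  have 2: "coeff (pCons 0 h) i \<in> I"
    using hcoeff I0 by (cases i) auto
  have 3: "coeff [:poly g (a s):] i \<in> I"
    using gs I0 by (cases i) auto
  have "coeff g i = coeff (smult (- a s) h) i + coeff (pCons 0 h) i + coeff [:poly g (a s):] i"
    by (subst g) simp
  then show ?case using 1 2 3 Iadd by metis
qed

text \<open>The ideal \<open>(p, f)\<close> of \<open>\<int>[X]\<close>, so that quotienting by it gives \<open>\<F>\<^sub>p[X]/(f)\<close> without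
  introducing a type that depends on \<open>p\<close>.\<close>

definition pf_ideal :: "nat \<Rightarrow> int poly \<Rightarrow> int poly set" where
  "pf_ideal p f = {[:int p:] * v + f * w | v w. True}"

lemma pf_ideal_zero: "0 \<in> pf_ideal p f"
  unfolding pf_ideal_def by (auto intro: exI[of _ 0])

lemma pf_ideal_add: "x \<in> pf_ideal p f \<Longrightarrow> y \<in> pf_ideal p f \<Longrightarrow> x + y \<in> pf_ideal p f"
proof -
  assume "x \<in> pf_ideal p f" "y \<in> pf_ideal p f"
  then obtain v w v' w' where "x = [:int p:] * v + f * w" "y = [:int p:] * v' + f * w'"
    unfolding pf_ideal_def by blast
  then have "x + y = [:int p:] * (v + v') + f * (w + w')"
    by (simp only: algebra_simps)
  then show ?thesis unfolding pf_ideal_def by blast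
qed

lemma pf_ideal_mult: "y \<in> pf_ideal p f \<Longrightarrow> x * y \<in> pf_ideal p f"
proof -
  assume "y \<in> pf_ideal p f"
  then obtain v w where "y = [:int p:] * v + f * w"
    unfolding pf_ideal_def by blast
  then have "x * y = [:int p:] * (x * v) + f * (x * w)"
    by (simp only: algebra_simps)
  then show ?thesis unfolding pf_ideal_def by blast
qed

lemma monic_division:
  fixes f u :: "'a::idom poly"
  assumes "lead_coeff f = 1"
  obtains w r where "u = f * w + r" "r = 0 \<or> degree r < degree f"
proof -
  have f0: "f \<noteq> 0" using assms by auto
  \<comment> \<open>Pseudo-division scales \<open>u\<close> by a power of the leading coefficient,
    here 1.\<close>
  obtain w r where wr: "pseudo_divmod u f = (w, r)" by force
  show thesis
    using that[of w r] pseudo_divmod[OF f0 wr] assms by simp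
qed

text \<open>Division by the monic \<open>f\<close>, then reduction of coefficients modulo
  \<open>p\<close>, brings every class to degree below \<open>e\<close> with coefficients in
  \<open>0..p-1\<close>. These \<open>p ^ e\<close> representatives become the alphabet.\<close>

lemma pf_ideal_representatives:
  assumes "lead_coeff f = 1" and "degree f = e" and "1 \<le> e" and "1 \<le> p"
  obtains Q where "finite Q" and "card Q = p ^ e"
    and "\<And>r r'. r \<in> Q \<Longrightarrow> r' \<in> Q \<Longrightarrow> r - r' \<in> pf_ideal p f \<Longrightarrow> r = r'"
    and "\<And>u. \<exists>r\<in>Q. u - r \<in> pf_ideal p f"
proof -
  define L where "L = {xs :: int list. set xs \<subseteq> {0..<int p} \<and> length xs = e}"
  define Q where "Q = Poly ` L"
  have finL: "finite L" unfolding L_def by (rule finite_lists_length_eq) simp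
  have cardL: "card L = p ^ e"
    unfolding L_def by (subst card_lists_length_eq) auto
  have coeffL: "coeff (Poly xs) i = (if i < e then xs ! i else 0)" if "xs \<in> L" for xs i
    using that by (simp add: L_def coeff_Poly_eq nth_default_def)
  have inj: "inj_on Poly L"
  proof (rule inj_onI)
    fix xs ys assume xy: "xs \<in> L" "ys \<in> L" "Poly xs = Poly ys"
    have "xs ! i = ys ! i" if "i < e" for i
      using coeffL[OF xy(1), of i] coeffL[OF xy(2), of i] xy(3) that by simp
    then show "xs = ys"
      using xy by (intro nth_equalityI) (auto simp: L_def)
  qed
  have range: "0 \<le> coeff r i \<and> coeff r i < int p" if "r \<in> Q" for r i
  proof -
    obtain xs where xs: "xs \<in> L" "r = Poly xs"
      using \<open>r \<in> Q\<close> unfolding Q_def by blast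
    show ?thesis
      using coeffL[OF xs(1), of i] xs assms(4) nth_mem[of i xs]
      by (auto simp: L_def simp del: nth_mem)
  qed
  have high: "coeff r i = 0" if "r \<in> Q" "i \<ge> e" for r i
    using that coeffL by (auto simp: Q_def)
  show thesis
  proof (rule that)
    show "finite Q" using finL by (simp add: Q_def)
    show "card Q = p ^ e" using inj cardL by (simp add: Q_def card_image)
  next
    fix r r' assume r: "r \<in> Q" "r' \<in> Q" "r - r' \<in> pf_ideal p f"
    then obtain v w where vw: "r - r' = [:int p:] * v + f * w"
      unfolding pf_ideal_def by blast
    obtain w' v' where v': "v = f * w' + v'" "v' = 0 \<or> degree v' < degree f"
      using monic_division[OF assms(1)] by blast
    \<comment> \<open>With \<open>v\<close> reduced modulo \<open>f\<close>, \<open>z\<close> is a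
      multiple of \<open>f\<close> without coefficients from \<open>e\<close> on, so it vanishes and
      \<open>p\<close> divides \<open>r - r'\<close>.\<close>
    define z where "z = r - r' - [:int p:] * v'"
    have z: "z = f * ([:int p:] * w' + w)"
      unfolding z_def vw v'(1) by (simp only: algebra_simps)
    have zc: "coeff z i = 0" if "i \<ge> e" for i
    proof -
      have "coeff v' i = 0"
        using v'(2) that assms(2) by (auto intro: coeff_eq_0)
      then show ?thesis using high r that by (simp add: z_def)
    qed
    have "z = 0"
    proof (rule ccontr)
      assume "z \<noteq> 0"
      then have "degree z \<ge> e"
        using z assms(2) degree_mult_eq[of f "[:int p:] * w' + w"] by auto
      then show False using zc[of "degree z"] \<open>z \<noteq> 0\<close> by simp
    qed
    then have rr: "r - r' = [:int p:] * v'" by (simp add: z_def)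
    show "r = r'"
    proof (rule poly_eqI)
      fix i
      have "coeff r i - coeff r' i = int p * coeff v' i"
        using arg_cong[OF rr, of "\<lambda>x. coeff x i"] by simp
      then have "coeff r i mod int p = coeff r' i mod int p"
        by (metis dvd_triv_left mod_eq_dvd_iff)
      then show "coeff r i = coeff r' i"
        using range[OF r(1), of i] range[OF r(2), of i] by simp
    qed
  next
    fix u :: "int poly"
    obtain w v where v: "u = f * w + v" "v = 0 \<or> degree v < degree f"
      using monic_division[OF assms(1)] by blast
    define xs where "xs = map (\<lambda>i. coeff v i mod int p) [0..<e]"
    have xs: "xs \<in> L"
      using assms(4) by (auto simp: L_def xs_def)
    define t where "t = map_poly (\<lambda>c. c div int p) v"
    have "v - Poly xs = [:int p:] * t"
    proof (rule poly_eqI)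
      fix i
      have "coeff v i = 0" if "i \<ge> e"
        using v(2) that assms(2) by (auto intro: coeff_eq_0)
      then show "coeff (v - Poly xs) i = coeff ([:int p:] * t) i"
        using coeffL[OF xs, of i] by (auto simp: t_def xs_def coeff_map_poly minus_mod_eq_mult_div)
    qed
    then have "u - Poly xs = [:int p:] * t + f * w"
      using v(1) by (simp add: algebra_simps)
    then show "\<exists>r\<in>Q. u - r \<in> pf_ideal p f"
      using xs unfolding Q_def pf_ideal_def by blast
  qed
qed

section \<open>Evaluation points and Reed-Solomon codes\<close>

text \<open>A prime power is large through its exponent or through its prime. For large
  \<open>e\<close> the points are powers of \<open>X\<close> and \<open>f\<close> is chosen to suit
  them; otherwise \<open>p > N\<close> and integer constants are already separated modulo
  \<open>p\<close>.\<close>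

lemma separated_points_exist:
  fixes N :: nat
  obtains q0 :: nat where "\<And>p e. prime p \<Longrightarrow> 1 \<le> e \<Longrightarrow> q0 \<le> p ^ e \<Longrightarrow>
    \<exists>f (a :: nat \<Rightarrow> int poly). lead_coeff f = 1 \<and> degree f = e \<and>
      (\<forall>s<N. \<forall>t<N. s \<noteq> t \<longrightarrow> (\<exists>u. (a s - a t) * u - 1 \<in> pf_ideal p f))"
proof -
  define T where "T = {(s, t). s < t \<and> t < N}"
  have finT: "finite T"
    by (rule finite_subset[of _ "{..<N} \<times> {..<N}"]) (auto simp: T_def)
  define D :: "nat \<times> nat \<Rightarrow> int poly" where "D = (\<lambda>(s, t). monom 1 t - monom 1 s)"
  define P where "P = prod D T"
  have "lead_coeff (D st) = 1" if "st \<in> T" for st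
  proof -
    obtain s t where "st = (s, t)" by fastforce
    with that have st: "st = (s, t)" "s < t" by (auto simp: T_def)
    have "degree (- monom 1 s + monom (1::int) t) = t"
      using st by (subst degree_add_eq_right) (auto simp: degree_monom_eq)
    then show ?thesis using st by (simp add: D_def)
  qed
  then have P1: "lead_coeff P = 1"
    unfolding P_def lead_coeff_prod by (simp add: prod.neutral)
  define d where "d = degree P"
  show thesis
  \<comment> \<open>If \<open>e < d\<close> and \<open>p <= N\<close>, then
    \<open>p ^ e <= (N + 1) ^ d\<close>; the extra 1 excludes this.\<close>
  proof (rule that[of "(N + 1) ^ d + 1"])
    fix p e :: nat assume p: "prime p" and e: "1 \<le> e" and q: "(N + 1) ^ d + 1 \<le> p ^ e"
    show "\<exists>f (a :: nat \<Rightarrow> int poly). lead_coeff f = 1 \<and> degree f = e \<and>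
      (\<forall>s<N. \<forall>t<N. s \<noteq> t \<longrightarrow> (\<exists>u. (a s - a t) * u - 1 \<in> pf_ideal p f))"
    proof (cases "d \<le> e")
      case True
      \<comment> \<open>\<open>f - 1\<close> is a multiple of every difference \<open>X\<^sup>t - X\<^sup>s\<close>, so these are units modulo \<open>f\<close>.
        As they are monic up to sign, \<open>deg P\<close> does not depend on \<open>p\<close>.\<close>
      define g where "g = P * monom 1 (e - d)"
      define f where "f = g + 1"
      have g1: "lead_coeff g = 1"
        unfolding g_def lead_coeff_mult by (simp add: P1 degree_monom_eq)
      have gd: "degree g = e"
        unfolding g_def using P1 True
        by (subst degree_mult_eq) (auto simp: degree_monom_eq d_def)
      have fd: "degree f = e"
        unfolding f_def using gd e by (subst degree_add_eq_left) auto
      have f1: "lead_coeff f = 1"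
        using fd gd g1 e by (simp add: f_def)
      have f_in: "f * w \<in> pf_ideal p f" for w
        unfolding pf_ideal_def by (auto intro: exI[of _ 0])
      have pos: "\<exists>u. (monom 1 t - monom 1 s) * u - 1 \<in> pf_ideal p f" if "s < t" "t < N" for s t
      proof -
        have "(s, t) \<in> T" using that by (simp add: T_def)
        then have "D (s, t) dvd P"
          unfolding P_def by (rule dvd_prodI[OF finT])
        then obtain w where w: "P = (monom 1 t - monom 1 s) * w"
          by (auto simp: D_def)
        have "(monom 1 t - monom 1 s) * (- w * monom 1 (e - d)) - 1 = f * (-1)"
          unfolding f_def g_def w by (simp add: algebra_simps)
        then show ?thesis using f_in by metis
      qed
      have "\<exists>u. (monom 1 s - monom 1 t) * u - 1 \<in> pf_ideal p f"
        if "s < N" "t < N" "s \<noteq> t" for s t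
      proof (cases "t < s")
        case True
        then show ?thesis using pos that by blast
      next
        case False
        then obtain u where "(monom 1 t - monom 1 s) * u - 1 \<in> pf_ideal p f"
          using pos[of s t] \<open>s \<noteq> t\<close> \<open>t < N\<close> by auto
        then have "(monom 1 s - monom 1 t) * (- u) - 1 \<in> pf_ideal p f"
          by (simp add: algebra_simps)
        then show ?thesis by blast
      qed
      then show ?thesis using fd f1 by (intro exI[of _ f] exI[of _ "\<lambda>s. monom 1 s"]) blast
    next
      case False
      have Np: "N < p"
      proof (rule ccontr)
        assume "\<not> N < p"
        then have "p ^ e \<le> (N + 1) ^ e" by (intro power_mono) auto
        also have "\<dots> \<le> (N + 1) ^ d" using False by (intro power_increasing) auto
        finally show False using q by simp
      qed
      have "\<exists>u. ([:int s:] - [:int t:]) * u - 1 \<in> pf_ideal p (monom 1 e)"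
        if "s < N" "t < N" "s \<noteq> t" for s t
      proof -
        have "coprime (int s - int t) (int p)"
        proof -
          have "\<not> int p dvd int s - int t"
          proof
            assume "int p dvd int s - int t"
            then have "int s mod int p = int t mod int p" by (simp add: mod_eq_dvd_iff)
            then show False using that Np by simp
          qed
          then show ?thesis
            using p by (simp add: prime_imp_coprime coprime_commute)
        qed
        then obtain x y where "x * (int s - int t) + y * int p = 1"
          using bezout_int[of "int s - int t" "int p"] by auto
        then have xy: "(int s - int t) * x - 1 = int p * (- y)"
          by (simp add: algebra_simps)
        have "([:int s:] - [:int t:]) * [:x:] - 1 = [:(int s - int t) * x - 1:]"
          by (simp add: one_pCons)
        also have "\<dots> = [:int p:] * [:- y:] + monom 1 e * 0"
          unfolding xy by simp
        finally show ?thesis unfolding pf_ideal_def by blast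
      qed
      then show ?thesis
        by (intro exI[of _ "monom 1 e"] exI[of _ "\<lambda>s. [:int s:]"]) (auto simp: degree_monom_eq)
    qed
  qed
qed

text \<open>File symbols are coefficients, code symbols are values at the separated points. Files
  agreeing at \<open>M\<close> points have a difference polynomial with \<open>M\<close> roots
  modulo the ideal, so all its coefficients lie there. The threshold depends on the length
  \<open>N\<close> only.\<close>

lemma mds_code_exists:
  fixes N :: nat
  obtains q0 :: nat where "\<And>q p e M. q0 \<le> q \<Longrightarrow> prime p \<Longrightarrow> 1 \<le> e \<Longrightarrow> q = p ^ e \<Longrightarrow>
    \<exists>C :: nat list \<Rightarrow> nat \<Rightarrow> nat. (\<forall>x i. C x i < q) \<and>
      (\<forall>x\<in>syms q M. \<forall>y\<in>syms q M. \<forall>S\<subseteq>{..<N}.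
         M \<le> card S \<longrightarrow> (\<forall>i\<in>S. C x i = C y i) \<longrightarrow> x = y)"
proof -
  obtain q0 :: nat where q0: "\<And>p e. prime p \<Longrightarrow> 1 \<le> e \<Longrightarrow> q0 \<le> p ^ e \<Longrightarrow>
    \<exists>f (a :: nat \<Rightarrow> int poly). lead_coeff f = 1 \<and> degree f = e \<and>
      (\<forall>s<N. \<forall>t<N. s \<noteq> t \<longrightarrow> (\<exists>u. (a s - a t) * u - 1 \<in> pf_ideal p f))"
    using separated_points_exist[of N] by blast
  show thesis
  proof (rule that[of q0])
    fix q p e M :: nat
    assume "q0 \<le> q" and p: "prime p" and e: "1 \<le> e" and q: "q = p ^ e"
    then obtain f and a :: "nat \<Rightarrow> int poly" where f: "lead_coeff f = 1" "degree f = e"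
      and a: "\<And>s t. s < N \<Longrightarrow> t < N \<Longrightarrow> s \<noteq> t \<Longrightarrow> \<exists>u. (a s - a t) * u - 1 \<in> pf_ideal p f"
      using q0 by blast
    define I where "I = pf_ideal p f"
    have Idiff: "x - y \<in> I" if "x \<in> I" "y \<in> I" for x y
      using pf_ideal_add[of x p f "- y"] pf_ideal_mult[of y p f "-1"] that by (simp add: I_def)
    have "1 \<le> p" using p by (rule prime_ge_1_nat)
    obtain Q where Q: "finite Q" "card Q = q"
      "\<And>r r'. r \<in> Q \<Longrightarrow> r' \<in> Q \<Longrightarrow> r - r' \<in> I \<Longrightarrow> r = r'"
      "\<And>u. \<exists>r\<in>Q. u - r \<in> I"
      using pf_ideal_representatives[OF f e \<open>1 \<le> p\<close>] unfolding I_def q by blast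
    \<comment> \<open>\<open>\<phi>\<close> turns a symbol into its representative,
      \<open>\<psi>\<close> below turns a ring element into the symbol of its class.\<close>
    obtain \<phi> where \<phi>: "bij_betw \<phi> {..<q} Q"
      using ex_bij_betw_nat_finite[OF Q(1)] Q(2) by (auto simp: atLeast0LessThan)
    have "\<exists>c<q. u - \<phi> c \<in> I" for u
      using Q(4)[of u] \<phi> by (auto simp: bij_betw_def)
    then obtain \<psi> where \<psi>: "\<And>u. \<psi> u < q" "\<And>u. u - \<phi> (\<psi> u) \<in> I" by metis
    define G where "G x = Poly (map \<phi> x)" for x
    define C where "C x i = \<psi> (poly (G x) (a i))" for x i
    have "x = y" if x: "x \<in> syms q M" and y: "y \<in> syms q M" and S: "S \<subseteq> {..<N}"
      and M: "M \<le> card S" and eq: "\<And>i. i \<in> S \<Longrightarrow> C x i = C y i" for x y S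
    proof -
      have len: "length x = M" "length y = M" and ran: "set x \<subseteq> {..<q}" "set y \<subseteq> {..<q}"
        using x y by (auto simp: syms_def)
      have Ic: "coeff (G x - G y) j \<in> I" for j
      proof (rule coeff_in_ideal_of_roots)
        show "0 \<in> I" "\<And>x y. x \<in> I \<Longrightarrow> y \<in> I \<Longrightarrow> x + y \<in> I" "\<And>x y. y \<in> I \<Longrightarrow> x * y \<in> I"
          unfolding I_def by (rule pf_ideal_zero pf_ideal_add pf_ideal_mult; assumption)+
        show "finite S" using S by (rule finite_subset) simp
        show "coeff (G x - G y) i = 0" if "card S \<le> i" for i
          using that M len by (simp add: G_def coeff_Poly_eq nth_default_def)
        show "poly (G x - G y) (a i) \<in> I" if "i \<in> S" for i
          using Idiff[OF \<psi>(2)[of "poly (G x) (a i)"] \<psi>(2)[of "poly (G y) (a i)"]] eq[OF that]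
          by (simp add: C_def)
        show "\<exists>u. (a s - a t) * u - 1 \<in> I" if "s \<in> S" "t \<in> S" "s \<noteq> t" for s t
          using a that S unfolding I_def by blast
      qed
      show "x = y"
      proof (rule nth_equalityI)
        show "length x = length y" using len by simp
        fix j assume j: "j < length x"
        then have mem: "x ! j \<in> {..<q}" "y ! j \<in> {..<q}"
          using ran len nth_mem by (metis subsetD)+
        have "\<phi> (x ! j) - \<phi> (y ! j) \<in> I"
          using Ic[of j] j len by (simp add: G_def coeff_Poly_eq nth_default_def)
        then have "\<phi> (x ! j) = \<phi> (y ! j)"
          using Q(3) mem \<phi> by (meson bij_betwE)
        then show "x ! j = y ! j"
          using \<phi> mem by (meson bij_betw_imp_inj_on inj_onD)
      qed
    qed
    then show "\<exists>C :: nat list \<Rightarrow> nat \<Rightarrow> nat. (\<forall>x i. C x i < q) \<and>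
      (\<forall>x\<in>syms q M. \<forall>y\<in>syms q M. \<forall>S\<subseteq>{..<N}.
         M \<le> card S \<longrightarrow> (\<forall>i\<in>S. C x i = C y i) \<longrightarrow> x = y)"
      using \<psi>(1) by (intro exI[of _ C]) (auto simp: C_def)
  qed
qed

section \<open>The upper bound\<close>

lemma card_syms: "card (syms q m) = q ^ m"
  using card_lists_length_eq[of "{..<q}" m] by (simp add: syms_def conj_commute)

lemma finite_syms: "finite (syms q m)"
  using finite_lists_length_eq[of "{..<q}" m] by (simp add: syms_def conj_commute)

section \<open>The failure history and the adversary\<close>

text \<open>Newcomer \<open>t\<close> hears from the earlier newcomers \<open>0..t-1\<close> and
  from \<open>n - 1 - t\<close> original nodes; only the latter bring new information.\<close>

definition successive_failures :: "nat \<Rightarrow> nat \<Rightarrow> hist" where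
  "successive_failures n k = map (\<lambda>t. (t, {..<n} - {t})) [0..<k]"

lemma length_successive_failures [simp]: "length (successive_failures n k) = k"
  by (simp add: successive_failures_def)

lemma nth_successive_failures [simp]: "t < k \<Longrightarrow> successive_failures n k ! t = (t, {..<n} - {t})"
  by (simp add: successive_failures_def)

lemma valid_successive_failures:
  assumes "k \<le> n"
  shows "valid_hist n (n - 1) (successive_failures n k)"
  using assms by (auto simp: valid_hist_def successive_failures_def)

lemma birth_successive_failures:
  "t \<le> k \<Longrightarrow> birth (successive_failures n k) t j = (if j < t then Suc j else 0)"
  by (induction t) auto

text \<open>Course-of-values recursion, used for the contents of successive newcomers; the guard
  \<open>j < t\<close> gives termination.\<close>

fun chain :: "(nat \<Rightarrow> (nat \<Rightarrow> 'a list) \<Rightarrow> 'a list) \<Rightarrow> nat \<Rightarrow> 'a list" where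
  "chain F t = F t (\<lambda>j. if j < t then chain F j else [])"

declare chain.simps [simp del]

text \<open>If the files \<open>x\<close> and \<open>y\<close> send the same messages from original nodes to the newcomers
  \<open>2b, \<dots>, k - 1\<close>, the adversary makes two scenarios look alike to a data collector reading slots
  \<open>0, \<dots>, k - 1\<close>: file \<open>x\<close> with the newcomers \<open>0, \<dots>, b - 1\<close> controlled and pretending that the
  file is \<open>y\<close>, and file \<open>y\<close> with the newcomers \<open>b, \<dots>, 2b - 1\<close> controlled and pretending that the
  file is \<open>x\<close>.\<close>

lemma confusable_files:
  assumes kn: "k < n"
    and msg: "\<And>h r j c. msg h r j c \<in> syms q \<beta>"
    and store: "\<And>h r m. store h r m \<in> syms q \<alpha>"
    and dec: "\<And>x fs B badmsg badread K.
      x \<in> syms q M \<Longrightarrow> valid_hist n (n - 1) fs \<Longrightarrow> finite B \<Longrightarrow> card B \<le> b \<Longrightarrow>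
      (\<And>t j. badmsg t j \<in> syms q \<beta>) \<Longrightarrow> (\<And>i. badread i \<in> syms q \<alpha>) \<Longrightarrow>
      K \<subseteq> {..<n} \<Longrightarrow> card K = k \<Longrightarrow>
      dec fs K (\<lambda>i. if i \<in> K then
                    (if (birth fs (length fs) i, i) \<in> B then badread i
                     else state enc msg store x fs B badmsg (length fs) i)
                  else []) = x"
    and x: "x \<in> syms q M" and y: "y \<in> syms q M"
    and agree: "\<And>t j. 2 * b \<le> t \<Longrightarrow> t < k \<Longrightarrow> t < j \<Longrightarrow> j < n \<Longrightarrow>
      msg (take t (successive_failures n k)) (t, {..<n} - {t}) j (enc j x) =
      msg (take t (successive_failures n k)) (t, {..<n} - {t}) j (enc j y)"
  shows "x = y"
proof -
  define fs where "fs = successive_failures n k"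
  define sent where "sent t j c = msg (take t fs) (t, {..<n} - {t}) j c" for t j c
  \<comment> \<open>The file that newcomer \<open>t\<close> appears to be built from in both
    scenarios. From \<open>2 * b\<close> on the choice of \<open>x\<close> is immaterial by
    \<open>agree\<close>.\<close>
  define z where "z t = (if t < b then y else x)" for t
  define c where "c = chain (\<lambda>t prev. store (take t fs) (t, {..<n} - {t})
    (\<lambda>j. if j \<in> {..<n} - {t} then sent t j (if j < t then prev j else enc j (z t)) else []))"
  have c: "c t = store (take t fs) (t, {..<n} - {t})
    (\<lambda>j. if j \<in> {..<n} - {t} then sent t j (if j < t then c j else enc j (z t)) else [])" for t
    unfolding c_def by (subst chain.simps) (simp cong: if_cong)
  \<comment> \<open>Both scenarios are instances: file \<open>w\<close>, controlled newcomers
    \<open>A\<close>, and honest newcomers that cannot tell \<open>w\<close> from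
    \<open>z t\<close>.\<close>
  have view: "dec fs {..<k} (\<lambda>i. if i < k then c i else []) = w"
    if w: "w \<in> syms q M" and finA: "finite A" and A: "card A \<le> b"
      and pretend: "\<And>t j. t < k \<Longrightarrow> t \<notin> A \<Longrightarrow> t < j \<Longrightarrow> j < n \<Longrightarrow>
        sent t j (enc j w) = sent t j (enc j (z t))" for w A
  proof -
    \<comment> \<open>The newcomer in slot \<open>j\<close> is created by step \<open>j + 1\<close>,
      counted from 1.\<close>
    define B where "B = (\<lambda>j. (Suc j, j)) ` A"
    define bm where "bm t j = sent t j (c j)" for t j
    have cB: "card B \<le> b"
      using card_image_le[OF finA, of "\<lambda>j. (Suc j, j)"] A by (simp add: B_def)
    have memB: "(birth fs t j, j) \<in> B \<longleftrightarrow> j < t \<and> j \<in> A" if "t \<le> k" for t j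
      using birth_successive_failures[OF that, of n j] by (auto simp: B_def fs_def)
    \<comment> \<open>Nothing is claimed for controlled newcomers: \<open>bm\<close> and the altered
      reads present \<open>c\<close> in their place.\<close>
    have st: "(i \<ge> t \<longrightarrow> state enc msg store w fs B bm t i = enc i w) \<and>
        (i < t \<and> i \<notin> A \<longrightarrow> state enc msg store w fs B bm t i = c i)" if "t \<le> k" for t i
      using that
    proof (induction t arbitrary: i)
      case 0
      then show ?case by simp
    next
      case (Suc t)
      define s where "s = state enc msg store w fs B bm t"
      have t: "t < k" and fst: "fs ! t = (t, {..<n} - {t})"
        using Suc.prems by (simp_all add: fs_def)
      have step: "state enc msg store w fs B bm (Suc t) i =
          (if i = t then store (take t fs) (t, {..<n} - {t})
             (\<lambda>j. if j \<in> {..<n} - {t} then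
                (if (birth fs t j, j) \<in> B then bm t j else sent t j (s j)) else [])
           else s i)"
        by (simp add: fst Let_def s_def sent_def cong: if_cong)
      have old: "s i = enc i w" if "i \<ge> t" for i
        using Suc.IH t that by (simp add: s_def)
      have new: "s i = c i" if "i < t" "i \<notin> A" for i
        using Suc.IH t that by (simp add: s_def)
      have "(if (birth fs t j, j) \<in> B then bm t j else sent t j (s j)) =
          sent t j (if j < t then c j else enc j (z t))" if "t \<notin> A" "j \<in> {..<n} - {t}" for j
        using that memB[of t j] t old[of j] new[of j] pretend[of t j]
        by (auto simp: bm_def)
      then have "state enc msg store w fs B bm (Suc t) i = c t" if "t \<notin> A" "i = t"
        using that unfolding step by (subst c) (simp cong: if_cong)
      then show ?case
        using old[of i] new[of i] step by (auto simp: less_Suc_eq)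
    qed
    have "dec fs {..<k} (\<lambda>i. if i \<in> {..<k} then
                    (if (birth fs (length fs) i, i) \<in> B then c i
                     else state enc msg store w fs B bm (length fs) i)
                  else []) = w"
    proof (rule dec[OF w])
      show "valid_hist n (n - 1) fs"
        unfolding fs_def using kn by (intro valid_successive_failures) simp
      show "finite B" using finA by (simp add: B_def)
      show "bm t j \<in> syms q \<beta>" for t j by (simp add: bm_def sent_def msg)
      show "c i \<in> syms q \<alpha>" for i by (subst c) (rule store)
    qed (use cB kn in auto)
    moreover have "(\<lambda>i. if i \<in> {..<k} then
                    (if (birth fs (length fs) i, i) \<in> B then c i
                     else state enc msg store w fs B bm (length fs) i)
                  else []) = (\<lambda>i. if i < k then c i else [])"
      using st[of k] memB[of k] by (auto simp: fs_def)
    ultimately show ?thesis by simp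
  qed
  have "dec fs {..<k} (\<lambda>i. if i < k then c i else []) = x"
    by (rule view[OF x, of "{..<b}"]) (auto simp: z_def)
  moreover have "dec fs {..<k} (\<lambda>i. if i < k then c i else []) = y"
    by (rule view[OF y, of "{b..<2 * b}"])
      (use agree in \<open>auto simp: z_def sent_def fs_def\<close>)
  ultimately show "x = y" by simp
qed

text \<open>Pigeonhole on the messages from original nodes to the newcomers
  \<open>2 * b..k-1\<close>; newcomer \<open>t\<close> accounts for the summand
  \<open>i = t + 1\<close>. For \<open>k <= 2 * b\<close> there are no such messages and the bound
  is 0.\<close>

lemma resilient_upper_bound:
  assumes kn: "k < n" and q: "2 \<le> q" and res: "resilient q n k (n - 1) b M \<alpha> \<beta>"
  shows "M \<le> (\<Sum>i\<in>{2 * b + 1..k}. (n - i) * \<beta>)"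
proof (rule ccontr)
  assume less: "\<not> M \<le> (\<Sum>i\<in>{2 * b + 1..k}. (n - i) * \<beta>)"
  obtain enc msg store dec where
    msg: "\<forall>h r j c. msg h r j c \<in> syms q \<beta>" and
    store: "\<forall>h r m. store h r m \<in> syms q \<alpha>" and
    dec: "\<forall>x \<in> syms q M. \<forall>fs. valid_hist n (n - 1) fs \<longrightarrow>
         (\<forall>B. finite B \<and> card B \<le> b \<longrightarrow>
          (\<forall>badmsg badread.
             (\<forall>t j. badmsg t j \<in> syms q \<beta>) \<longrightarrow> (\<forall>i. badread i \<in> syms q \<alpha>) \<longrightarrow>
             (\<forall>K. K \<subseteq> {..<n} \<and> card K = k \<longrightarrow>
                dec fs K (\<lambda>i. if i \<in> K then
                              (if (birth fs (length fs) i, i) \<in> B then badread i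
                               else state enc msg store x fs B badmsg (length fs) i)
                            else []) = x)))"
    using res unfolding resilient_def by (elim exE conjE) (rule that)
  define P where "P = (SIGMA t:{2 * b..<k}. {t<..<n})"
  \<comment> \<open>Restriction to \<open>P\<close> places \<open>g x\<close> in a finite
    extensional function space.\<close>
  define g where "g x = (\<lambda>(t, j)\<in>P.
    msg (take t (successive_failures n k)) (t, {..<n} - {t}) j (enc j x))" for x
  have finP: "finite P" by (simp add: P_def)
  have "card P = (\<Sum>t = 2 * b..<k. n - Suc t)"
    by (simp add: P_def)
  also have "\<dots> = (\<Sum>i = 2 * b + 1..k. n - i)"
    by (rule sum.reindex_bij_witness[of _ "\<lambda>i. i - 1" Suc]) auto
  finally have cardP: "card P = (\<Sum>i = 2 * b + 1..k. n - i)" .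
  have "g ` syms q M \<subseteq> P \<rightarrow>\<^sub>E syms q \<beta>"
    by (auto simp: g_def msg)
  then have "card (g ` syms q M) \<le> card (P \<rightarrow>\<^sub>E syms q \<beta>)"
    by (intro card_mono finite_PiE finP finite_syms)
  also have "\<dots> = q ^ (\<Sum>i\<in>{2 * b + 1..k}. (n - i) * \<beta>)"
    using cardP by (simp add: card_PiE finP card_syms flip: power_mult sum_distrib_right)
      (simp add: mult.commute)
  also have "\<dots> < card (syms q M)"
    unfolding card_syms using less q by (intro power_strict_increasing) auto
  finally have "\<not> inj_on g (syms q M)" by (rule pigeonhole)
  then obtain x y where xy: "x \<in> syms q M" "y \<in> syms q M" "x \<noteq> y" "g x = g y"
    by (auto simp: inj_on_def)
  have agree: "msg (take t (successive_failures n k)) (t, {..<n} - {t}) j (enc j x) =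
      msg (take t (successive_failures n k)) (t, {..<n} - {t}) j (enc j y)"
    if "2 * b \<le> t" "t < k" "t < j" "j < n" for t j
  proof -
    have "(t, j) \<in> P" using that by (simp add: P_def)
    then show ?thesis using fun_cong[OF xy(4), of "(t, j)"] by (simp add: g_def)
  qed
  have "x = y"
  proof (rule confusable_files[where msg = msg and store = store and dec = dec and enc = enc])
    show "dec fs K (\<lambda>i. if i \<in> K then
              (if (birth fs (length fs) i, i) \<in> B then badread i
               else state enc msg store x fs B badmsg (length fs) i)
            else []) = x"
      if "x \<in> syms q M" "valid_hist n (n - 1) fs" "finite B" "card B \<le> b"
        "\<And>t j. badmsg t j \<in> syms q \<beta>" "\<And>i. badread i \<in> syms q \<alpha>" "K \<subseteq> {..<n}" "card K = k"
      for x fs B badmsg badread K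
      using that by (intro dec[rule_format]) simp_all
  qed (use kn msg store xy agree in blast)+
  then show False using xy(3) by simp
qed

section \<open>Repair by transfer\<close>

text \<open>\<open>chunk i j\<close> is the position among the contents of slot \<open>i\<close> of the block shared with slot
  \<open>j \<noteq> i\<close>, and \<open>neighbour i\<close> is its inverse.\<close>

definition chunk :: "nat \<Rightarrow> nat \<Rightarrow> nat" where
  "chunk i j = (if j < i then j else j - 1)"

definition neighbour :: "nat \<Rightarrow> nat \<Rightarrow> nat" where
  "neighbour i c = (if c < i then c else Suc c)"

lemma neighbour_chunk: "j \<noteq> i \<Longrightarrow> neighbour i (chunk i j) = j"
  by (auto simp: neighbour_def chunk_def)

lemma chunk_less: "i < n \<Longrightarrow> j < n \<Longrightarrow> j \<noteq> i \<Longrightarrow> chunk i j < n - 1"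
  by (auto simp: chunk_def)

lemma block_index_less:
  fixes a c s \<beta> :: nat
  assumes "a < c" and "s < \<beta>"
  shows "a * \<beta> + s < c * \<beta>"
proof -
  have "a * \<beta> + s < Suc a * \<beta>" using assms by simp
  also have "\<dots> \<le> c * \<beta>" using assms by (intro mult_le_mono1) simp
  finally show ?thesis .
qed

text \<open>The codeword position of symbol \<open>s\<close> of the block on edge \<open>{i, j}\<close> of the complete graph.\<close>

definition edge_pos :: "nat \<Rightarrow> nat \<Rightarrow> nat \<Rightarrow> nat \<Rightarrow> nat \<Rightarrow> nat" where
  "edge_pos n \<beta> i j s = (min i j * n + max i j) * \<beta> + s"

lemma edge_pos_commute: "edge_pos n \<beta> i j s = edge_pos n \<beta> j i s"
  by (simp add: edge_pos_def min.commute max.commute)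

lemma edge_pos_less:
  assumes "i < n" "j < n" "s < \<beta>"
  shows "edge_pos n \<beta> i j s < n * n * \<beta>"
  unfolding edge_pos_def using assms by (intro block_index_less) auto

lemma block_index_inject:
  fixes a c s s' \<beta> :: nat
  assumes "a * \<beta> + s = c * \<beta> + s'" "s < \<beta>" "s' < \<beta>"
  shows "a = c \<and> s = s'"
proof -
  have "(a * \<beta> + s) div \<beta> = (c * \<beta> + s') div \<beta>" "(a * \<beta> + s) mod \<beta> = (c * \<beta> + s') mod \<beta>"
    using assms(1) by simp_all
  then show ?thesis using assms(2,3) by simp
qed

lemma edge_pos_inject:
  assumes "edge_pos n \<beta> i j s = edge_pos n \<beta> i' j' s'"
    and "i < n" "j < n" "i' < n" "j' < n" "s < \<beta>" "s' < \<beta>"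
  shows "{i, j} = {i', j'} \<and> s = s'"
proof -
  have 1: "min i j * n + max i j = min i' j' * n + max i' j'" and s: "s = s'"
    using block_index_inject[OF assms(1)[unfolded edge_pos_def] assms(6,7)] by auto
  have "min i j = min i' j' \<and> max i j = max i' j'"
    using block_index_inject[OF 1] assms by simp
  then show ?thesis using s by (auto simp: min_def max_def split: if_splits)
qed

section \<open>Counting edge symbols\<close>

text \<open>The \<open>r\<close>-th vertex added to \<open>A\<close> contributes its edges to the
  \<open>card V - r\<close> vertices of \<open>V\<close> not yet in \<open>A\<close>.\<close>

lemma card_edges_incident:
  assumes "finite V" and "A \<subseteq> V"
  shows "card {{i, j} | i j. i \<in> A \<and> j \<in> V \<and> j \<noteq> i} = (\<Sum>r = 1..card A. card V - r)"
proof -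
  have "finite A" using assms by (rule finite_subset[rotated])
  then show ?thesis
    using assms(2)
  proof (induction A rule: finite_induct)
    case empty
    then show ?case by simp
  next
    case (insert a A)
    let ?E = "\<lambda>A. {{i, j} | i j. i \<in> A \<and> j \<in> V \<and> j \<noteq> i}"
    let ?N = "V - insert a A"
    have E: "?E (insert a A) = ?E A \<union> (\<lambda>j. {a, j}) ` ?N"
      using insert.prems by (auto simp: doubleton_eq_iff)
    have fin: "finite (?E A)"
      by (rule finite_subset[of _ "Pow V"]) (use insert.prems assms(1) in auto)
    have "card (?E (insert a A)) = card (?E A) + card ((\<lambda>j. {a, j}) ` ?N)"
      unfolding E
      by (rule card_Un_disjoint) (use fin assms(1) insert.hyps in \<open>auto simp: doubleton_eq_iff\<close>)
    also have "card ((\<lambda>j. {a, j}) ` ?N) = card ?N"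
      by (rule card_image) (auto simp: inj_on_def doubleton_eq_iff)
    also have "card ?N = card V - Suc (card A)"
      using insert assms(1) by (subst card_Diff_subset) auto
    finally show ?case using insert by simp
  qed
qed

lemma card_edge_positions:
  assumes V: "V \<subseteq> {..<n}" and A: "A \<subseteq> V"
  shows "card {edge_pos n \<beta> i j s | i j s. i \<in> A \<and> j \<in> V \<and> j \<noteq> i \<and> s < \<beta>} =
    (\<Sum>r = 1..card A. card V - r) * \<beta>"
proof -
  let ?E = "{{i, j} | i j. i \<in> A \<and> j \<in> V \<and> j \<noteq> i}"
  \<comment> \<open>\<open>Min\<close> and \<open>Max\<close> make the position a function of the
    unordered edge.\<close>
  define g where "g = (\<lambda>(e, s). edge_pos n \<beta> (Min e) (Max e) s)"
  have g: "g ({i, j}, s) = edge_pos n \<beta> i j s" for i j s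
    by (simp add: g_def edge_pos_def min_def max_def)
  have finV: "finite V" using V by (rule finite_subset) simp
  have "inj_on g (?E \<times> {..<\<beta>})"
  proof (rule inj_onI)
    fix u v assume u: "u \<in> ?E \<times> {..<\<beta>}" and v: "v \<in> ?E \<times> {..<\<beta>}" and uv: "g u = g v"
    obtain i j s where u': "u = ({i, j}, s)" "i \<in> A" "j \<in> V" "s < \<beta>" using u by auto
    obtain i' j' s' where v': "v = ({i', j'}, s')" "i' \<in> A" "j' \<in> V" "s' < \<beta>" using v by auto
    show "u = v"
      using edge_pos_inject[of n \<beta> i j s i' j' s'] uv u' v' V A by (auto simp: g)
  qed
  then have "card (g ` (?E \<times> {..<\<beta>})) = card ?E * \<beta>"
    by (simp add: card_image card_cartesian_product)
  moreover have "g ` (?E \<times> {..<\<beta>}) =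
      {edge_pos n \<beta> i j s | i j s. i \<in> A \<and> j \<in> V \<and> j \<noteq> i \<and> s < \<beta>}"
    by (force simp: g[symmetric])
  ultimately show ?thesis
    using card_edges_incident[OF finV A] by simp
qed

text \<open>Deleting at most \<open>2 * b\<close> suspect slots leaves \<open>a\<close> of the read
  slots and \<open>v\<close> of all slots; shifting the index by \<open>2 * b\<close> compares the
  sums termwise.\<close>

lemma edge_count_ge:
  assumes "2 * b < k" "k < n" "k - 2 * b \<le> a" "n - 2 * b \<le> v"
  shows "(\<Sum>i\<in>{2 * b + 1..k}. (n - i) * \<beta>) \<le> (\<Sum>r = 1..a. v - r) * (\<beta>::nat)"
proof -
  have "(\<Sum>i\<in>{2 * b + 1..k}. n - i) = (\<Sum>r = 1..k - 2 * b. n - 2 * b - r)"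
    by (rule sum.reindex_bij_witness[of _ "\<lambda>r. r + 2 * b" "\<lambda>i. i - 2 * b"]) auto
  also have "\<dots> \<le> (\<Sum>r = 1..k - 2 * b. v - r)"
    using assms by (intro sum_mono) simp
  also have "\<dots> \<le> (\<Sum>r = 1..a. v - r)"
    using assms by (intro sum_mono2) auto
  finally show ?thesis
    by (simp flip: sum_distrib_right)
qed

section \<open>Encoding, repair and decoding\<close>

text \<open>Every edge symbol is stored at both ends, so repair is mere copying.\<close>

definition mbr_enc :: "nat \<Rightarrow> nat \<Rightarrow> (nat list \<Rightarrow> nat \<Rightarrow> nat) \<Rightarrow> nat \<Rightarrow> nat list \<Rightarrow> nat list" where
  "mbr_enc n \<beta> C i x =
     map (\<lambda>u. C x (edge_pos n \<beta> i (neighbour i (u div \<beta>)) (u mod \<beta>))) [0..<(n - 1) * \<beta>]"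

text \<open>Reduction modulo \<open>q\<close> only serves to return symbols of the alphabet on junk inputs.\<close>

definition mbr_msg :: "nat \<Rightarrow> nat \<Rightarrow> hist \<Rightarrow> nat \<times> nat set \<Rightarrow> nat \<Rightarrow> nat list \<Rightarrow> nat list" where
  "mbr_msg q \<beta> h r j c = map (\<lambda>s. c ! (chunk j (fst r) * \<beta> + s) mod q) [0..<\<beta>]"

definition mbr_store ::
  "nat \<Rightarrow> nat \<Rightarrow> nat \<Rightarrow> hist \<Rightarrow> nat \<times> nat set \<Rightarrow> (nat \<Rightarrow> nat list) \<Rightarrow> nat list" where
  "mbr_store q n \<beta> h r m =
     map (\<lambda>u. m (neighbour (fst r) (u div \<beta>)) ! (u mod \<beta>) mod q) [0..<(n - 1) * \<beta>]"

lemma nth_mbr_msg: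
  "s < \<beta> \<Longrightarrow> mbr_msg q \<beta> h r j c ! s = c ! (chunk j (fst r) * \<beta> + s) mod q"
  by (simp add: mbr_msg_def)

lemma nth_mbr_store:
  "u < (n - 1) * \<beta> \<Longrightarrow>
    mbr_store q n \<beta> h r m ! u = m (neighbour (fst r) (u div \<beta>)) ! (u mod \<beta>) mod q"
  by (simp add: mbr_store_def)

text \<open>A controlled node corrupts only edges at its own slot, and these at both ends at worst, since
  every other edge is always re-copied from its honest end.\<close>

lemma mbr_uncorrupted_edges:
  assumes C: "\<And>x i. C x i < q" and fs: "valid_hist n (n - 1) fs" and t: "t \<le> length fs"
    and "i < n" "j < n" "i \<noteq> j" "i \<notin> snd ` B" "j \<notin> snd ` B" "s < \<beta>"
  shows "state (mbr_enc n \<beta> C) (mbr_msg q \<beta>) (mbr_store q n \<beta>) x fs B bm t i !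
    (chunk i j * \<beta> + s) = C x (edge_pos n \<beta> i j s)"
  using t assms(4-)
proof (induction t arbitrary: i j s)
  case 0
  then have "chunk i j * \<beta> + s < (n - 1) * \<beta>"
    by (intro block_index_less chunk_less) auto
  then show ?case
    using 0 by (simp add: mbr_enc_def neighbour_chunk)
next
  case (Suc t)
  obtain f H where fH: "fs ! t = (f, H)" by force
  have "(f, H) \<in> set fs" using Suc.prems(1) fH nth_mem[of t fs] by simp
  then have H: "H \<subseteq> {..<n} - {f}" "card H = n - 1" "f < n"
    using fs by (auto simp: valid_hist_def)
  \<comment> \<open>With \<open>d = n - 1\<close> every other slot helps, in particular
    \<open>j\<close>.\<close>
  then have Hall: "H = {..<n} - {f}"
    by (intro card_subset_eq) auto
  show ?case
  proof (cases "i = f")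
    case True
    have u: "chunk i j * \<beta> + s < (n - 1) * \<beta>"
      using Suc.prems by (intro block_index_less chunk_less) auto
    have jB: "(birth fs t j, j) \<notin> B" using Suc.prems by (force simp: image_iff)
    \<comment> \<open>The newcomer copies the block from its other end \<open>j\<close>, where it
      sits at \<open>chunk j i\<close>.\<close>
    have IH: "state (mbr_enc n \<beta> C) (mbr_msg q \<beta>) (mbr_store q n \<beta>) x fs B bm t j !
        (chunk j i * \<beta> + s) = C x (edge_pos n \<beta> j i s)"
      using Suc.prems by (intro Suc.IH) auto
    show ?thesis
      using True u jB IH Suc.prems C Hall
      by (simp add: fH Let_def nth_mbr_store nth_mbr_msg neighbour_chunk edge_pos_commute[of n \<beta> j f])
  next
    case False
    then show ?thesis
      using Suc.IH[of i j s] Suc.prems by (simp add: fH Let_def)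
  qed
qed

text \<open>\<open>S\<close> is a guess at the slots that ever hosted controlled nodes. Both ends of
  an edge must avoid it, as an honest node may have copied from a controlled one.\<close>

definition explains ::
  "nat \<Rightarrow> nat \<Rightarrow> nat \<Rightarrow> (nat list \<Rightarrow> nat \<Rightarrow> nat) \<Rightarrow> nat set \<Rightarrow> (nat \<Rightarrow> nat list) \<Rightarrow> nat list \<Rightarrow> bool" where
  "explains n b \<beta> C K rd x \<longleftrightarrow>
     (\<exists>S. finite S \<and> card S \<le> b \<and> (\<forall>i\<in>K - S. \<forall>j<n. j \<notin> S \<and> j \<noteq> i \<longrightarrow>
        (\<forall>s<\<beta>. rd i ! (chunk i j * \<beta> + s) = C x (edge_pos n \<beta> i j s))))"

text \<open>The two guesses together cover at most \<open>2 * b\<close> slots; the edges at read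
  slots that avoid them carry at least \<open>M\<close> symbols, on which both files agree with the
  read data.\<close>

lemma explains_unique:
  assumes mds: "\<And>S. S \<subseteq> {..<n * n * \<beta>} \<Longrightarrow> M \<le> card S \<Longrightarrow> (\<And>i. i \<in> S \<Longrightarrow> C x i = C y i) \<Longrightarrow> x = y"
    and M: "M = (\<Sum>i\<in>{2 * b + 1..k}. (n - i) * \<beta>)"
    and b: "2 * b < k" and kn: "k < n" and K: "K \<subseteq> {..<n}" "card K = k"
    and x: "explains n b \<beta> C K rd x" and y: "explains n b \<beta> C K rd y"
  shows "x = y"
proof -
  obtain S where S: "finite S" "card S \<le> b" "\<And>i j s. i \<in> K \<Longrightarrow> i \<notin> S \<Longrightarrow> j < n \<Longrightarrow> j \<notin> S \<Longrightarrow> j \<noteq> i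
      \<Longrightarrow> s < \<beta> \<Longrightarrow> rd i ! (chunk i j * \<beta> + s) = C x (edge_pos n \<beta> i j s)"
    using x unfolding explains_def by blast
  obtain S' where S': "finite S'" "card S' \<le> b" "\<And>i j s. i \<in> K \<Longrightarrow> i \<notin> S' \<Longrightarrow> j < n \<Longrightarrow> j \<notin> S'
      \<Longrightarrow> j \<noteq> i \<Longrightarrow> s < \<beta> \<Longrightarrow> rd i ! (chunk i j * \<beta> + s) = C y (edge_pos n \<beta> i j s)"
    using y unfolding explains_def by blast
  define T where "T = S \<union> S'"
  have T: "finite T" "card T \<le> 2 * b"
    using S(1,2) S'(1,2) card_Un_le[of S S'] by (auto simp: T_def)
  define A where "A = K - T"
  define V where "V = {..<n} - T"
  define P where "P = {edge_pos n \<beta> i j s | i j s. i \<in> A \<and> j \<in> V \<and> j \<noteq> i \<and> s < \<beta>}"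
  have VA: "V \<subseteq> {..<n}" "A \<subseteq> V" using K by (auto simp: V_def A_def)
  have "k - 2 * b \<le> card A" "n - 2 * b \<le> card V"
    using diff_card_le_card_Diff[OF T(1), of K] diff_card_le_card_Diff[OF T(1), of "{..<n}"] T(2) K(2)
    by (auto simp: A_def V_def)
  then have "M \<le> card P"
    unfolding P_def card_edge_positions[OF VA] M using b kn by (intro edge_count_ge)
  moreover have "P \<subseteq> {..<n * n * \<beta>}"
    using VA by (auto simp: P_def subset_iff intro!: edge_pos_less)
  moreover have "C x u = C y u" if "u \<in> P" for u
  proof -
    obtain i j s where "u = edge_pos n \<beta> i j s" "i \<in> A" "j \<in> V" "j \<noteq> i" "s < \<beta>"
      using \<open>u \<in> P\<close> unfolding P_def by blast
    then show ?thesis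
      using S(3)[of i j s] S'(3)[of i j s] by (auto simp: A_def V_def T_def)
  qed
  ultimately show "x = y" by (intro mds)
qed

lemma resilient_mbr:
  assumes C: "\<And>x i. C x i < q" and q: "0 < q"
    and mds: "\<And>x y S. x \<in> syms q M \<Longrightarrow> y \<in> syms q M \<Longrightarrow> S \<subseteq> {..<n * n * \<beta>} \<Longrightarrow> M \<le> card S \<Longrightarrow>
      (\<And>i. i \<in> S \<Longrightarrow> C x i = C y i) \<Longrightarrow> x = y"
    and M: "M = (\<Sum>i\<in>{2 * b + 1..k}. (n - i) * \<beta>)"
    and b: "2 * b < k" and kn: "k < n"
  shows "resilient q n k (n - 1) b M ((n - 1) * \<beta>) \<beta>"
proof -
  \<comment> \<open>Any file with an explanation will do: the true one has one, and it is
    unique.\<close>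
  define dec :: "hist \<Rightarrow> nat set \<Rightarrow> (nat \<Rightarrow> nat list) \<Rightarrow> nat list" where
    "dec fs K rd = (SOME x. x \<in> syms q M \<and> explains n b \<beta> C K rd x)" for fs K rd
  have enc_syms: "mbr_enc n \<beta> C i x \<in> syms q ((n - 1) * \<beta>)" for i x
    by (auto simp: mbr_enc_def syms_def C)
  have msg_syms: "mbr_msg q \<beta> h r j c \<in> syms q \<beta>" for h r j c
    using q by (auto simp: mbr_msg_def syms_def)
  have store_syms: "mbr_store q n \<beta> h r m \<in> syms q ((n - 1) * \<beta>)" for h r m
    using q by (auto simp: mbr_store_def syms_def)
  have "dec fs K (\<lambda>i. if i \<in> K then
            (if (birth fs (length fs) i, i) \<in> B then badread i
             else state (mbr_enc n \<beta> C) (mbr_msg q \<beta>) (mbr_store q n \<beta>) x fs B badmsg (length fs) i)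
          else []) = x" (is "dec fs K ?rd = x")
    if x: "x \<in> syms q M" and fs: "valid_hist n (n - 1) fs" and B: "finite B" "card B \<le> b"
      and K: "K \<subseteq> {..<n}" "card K = k" for x fs B badmsg badread K
  proof -
    have ex: "explains n b \<beta> C K ?rd x"
      unfolding explains_def
    proof (intro exI[of _ "snd ` B"] conjI ballI allI impI)
      show "finite (snd ` B)" using B by simp
      show "card (snd ` B) \<le> b" using card_image_le[OF B(1), of snd] B(2) by simp
      fix i j s assume i: "i \<in> K - snd ` B" and j: "j < n" "j \<notin> snd ` B \<and> j \<noteq> i" and s: "s < \<beta>"
      have iB: "(birth fs (length fs) i, i) \<notin> B" using i by (force simp: image_iff)
      have "state (mbr_enc n \<beta> C) (mbr_msg q \<beta>) (mbr_store q n \<beta>) x fs B badmsg (length fs) i !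
          (chunk i j * \<beta> + s) = C x (edge_pos n \<beta> i j s)"
        by (rule mbr_uncorrupted_edges[OF C fs]) (use i j s K in auto)
      then show "?rd i ! (chunk i j * \<beta> + s) = C x (edge_pos n \<beta> i j s)"
        using i iB by simp
    qed
    show ?thesis
      unfolding dec_def
    proof (rule some_equality)
      show "x \<in> syms q M \<and> explains n b \<beta> C K ?rd x" using x ex by simp
      fix y assume y: "y \<in> syms q M \<and> explains n b \<beta> C K ?rd y"
      show "y = x"
        by (rule explains_unique[OF mds M b kn K, where rd = ?rd]) (use x y ex in auto)
    qed
  qed
  then show ?thesis
    unfolding resilient_def using enc_syms msg_syms store_syms
    by (intro exI[of _ "mbr_enc n \<beta> C"] exI[of _ "mbr_msg q \<beta>"] exI[of _ "mbr_store q n \<beta>"]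
        exI[of _ dec] conjI allI ballI impI) simp_all
qed

section \<open>The capacity\<close>

theorem theorem4:
  fixes n k b \<beta> :: nat
  assumes "1 \<le> k" and "k \<le> n - 1" and "1 \<le> \<beta>"
  shows "\<exists>q0. \<forall>q. q0 \<le> q \<and> (\<exists>p e. prime (p::nat) \<and> 1 \<le> e \<and> q = p ^ e) \<longrightarrow>
           (2 * b < k \<longrightarrow>
              capacity_BL q n k (n - 1) b \<beta> = enat (\<Sum>i\<in>{2 * b + 1..k}. (n - i) * \<beta>) \<and>
              resilient q n k (n - 1) b (\<Sum>i\<in>{2 * b + 1..k}. (n - i) * \<beta>) ((n - 1) * \<beta>) \<beta>) \<and>
           (k \<le> 2 * b \<longrightarrow> capacity_BL q n k (n - 1) b \<beta> = 0)"
proof -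
  let ?M = "\<Sum>i\<in>{2 * b + 1..k}. (n - i) * \<beta>"
  have kn: "k < n" using assms by simp
  \<comment> \<open>All edge positions lie below \<open>n * n * \<beta>\<close>, so this is the code
    length.\<close>
  obtain q0 where q0: "\<And>q p e M. q0 \<le> q \<Longrightarrow> prime p \<Longrightarrow> 1 \<le> e \<Longrightarrow> q = p ^ e \<Longrightarrow>
    \<exists>C :: nat list \<Rightarrow> nat \<Rightarrow> nat. (\<forall>x i. C x i < q) \<and>
      (\<forall>x\<in>syms q M. \<forall>y\<in>syms q M. \<forall>S\<subseteq>{..<n * n * \<beta>}.
         M \<le> card S \<longrightarrow> (\<forall>i\<in>S. C x i = C y i) \<longrightarrow> x = y)"
    by (rule mds_code_exists[of "n * n * \<beta>"]) (rule that)
  have res: "resilient q n k (n - 1) b ?M ((n - 1) * \<beta>) \<beta>"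
    if q: "q0 \<le> q" "2 \<le> q" "prime p" "1 \<le> e" "q = p ^ e" "2 * b < k" for q p e :: nat
  proof -
    have "\<exists>C :: nat list \<Rightarrow> nat \<Rightarrow> nat. (\<forall>x i. C x i < q) \<and>
      (\<forall>x\<in>syms q ?M. \<forall>y\<in>syms q ?M. \<forall>S\<subseteq>{..<n * n * \<beta>}.
         ?M \<le> card S \<longrightarrow> (\<forall>i\<in>S. C x i = C y i) \<longrightarrow> x = y)"
      by (rule q0[OF q(1,3-5)])
    then obtain C :: "nat list \<Rightarrow> nat \<Rightarrow> nat" where C: "\<forall>x i. C x i < q"
      and mds: "\<forall>x\<in>syms q ?M. \<forall>y\<in>syms q ?M. \<forall>S\<subseteq>{..<n * n * \<beta>}.
         ?M \<le> card S \<longrightarrow> (\<forall>i\<in>S. C x i = C y i) \<longrightarrow> x = y"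
      by (elim exE conjE)
    show ?thesis
    proof (rule resilient_mbr[OF C[rule_format] _ _ refl])
      show "x = y" if "x \<in> syms q ?M" "y \<in> syms q ?M" "S \<subseteq> {..<n * n * \<beta>}" "?M \<le> card S"
        "\<And>i. i \<in> S \<Longrightarrow> C x i = C y i" for x y S
        by (rule mds[rule_format]) (rule that, assumption?)+
    qed (use q(2,6) kn in linarith)+
  qed
  have upper: "capacity_BL q n k (n - 1) b \<beta> \<le> enat ?M" if "2 \<le> q" for q
    unfolding capacity_BL_def
  proof (rule Sup_least, clarify)
    fix M \<alpha> \<beta>' assume \<beta>': "\<beta>' \<le> \<beta>" and "resilient q n k (n - 1) b M \<alpha> \<beta>'"
    then have "M \<le> (\<Sum>i\<in>{2 * b + 1..k}. (n - i) * \<beta>')"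
      using resilient_upper_bound[OF kn that] by blast
    also have "\<dots> \<le> ?M" using \<beta>' by (intro sum_mono mult_le_mono2)
    finally show "enat M \<le> enat ?M" by simp
  qed
  have lower: "enat ?M \<le> capacity_BL q n k (n - 1) b \<beta>"
    if "resilient q n k (n - 1) b ?M ((n - 1) * \<beta>) \<beta>" for q
    unfolding capacity_BL_def by (rule Sup_upper) (use that in blast)
  show ?thesis
  proof (rule exI[of _ "max q0 2"], intro allI impI, elim conjE exE)
    fix q p e :: nat assume q: "max q0 2 \<le> q" "prime p" "1 \<le> e" "q = p ^ e"
    have q': "q0 \<le> q" "2 \<le> q" using q(1) by simp_all
    \<comment> \<open>Here the sum in the upper bound is empty.\<close>
    have zero: "capacity_BL q n k (n - 1) b \<beta> = 0" if "k \<le> 2 * b"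
      using upper[OF q'(2)] that by (simp flip: zero_enat_def)
    have "capacity_BL q n k (n - 1) b \<beta> = enat ?M" if "2 * b < k"
      using upper[OF q'(2)] lower[OF res[OF q' q(2-4) that]] by (rule antisym)
    then show "(2 * b < k \<longrightarrow> capacity_BL q n k (n - 1) b \<beta> = enat ?M \<and>
          resilient q n k (n - 1) b ?M ((n - 1) * \<beta>) \<beta>) \<and>
        (k \<le> 2 * b \<longrightarrow> capacity_BL q n k (n - 1) b \<beta> = 0)"
      using res[OF q' q(2-4)] zero by blast
  qed
qed

end
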